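(* Let $n,d$ be integers with $n-1\ge d\ge 3$, and let $\mathcal K_n^d$ be the complete $d$-uniform hypergraph on $n$ vertices. (i) For $1\le k\le d-2$, $EI^k(\mathcal K_n^d)=\mathcal K_n^{d-k}\cup\mathcal K_n^{d-k-1}\cup\dots\cup\mathcal K_n^{t_k}$, where $t_k=\max\{2,\,2^k(d-n)+n\}$. (ii) $k^{EI}(\mathcal K_n^d)=d-1$.
   Context: $\mathcal K_n^r$ denotes the hypergraph with vertex set $\{v_1,\dots,v_n\}$ whose hyperedges are all $r$-element subsets of the vertex set; all these hypergraphs share the vertex set $\{v_1,\dots,v_n\}$, and their union is the hypergraph on that vertex set whose edge set is the union of their edge sets. For a hypergraph $\mathcal H=(V,\mathcal E)$, $EI(\mathcal H)=(V,\mathcal E^{EI})$ with $\mathcal E^{EI}=\{e_1\cap e_2 \mid e_1,e_2\in\mathcal E,\ e_1\neq e_2,\ |e_1\cap e_2|\ge 2\}$; $EI^0(\mathcal H)=\mathcal H$, $EI^k(\mathcal H)=EI(EI^{k-1}(\mathcal H))$. The EI-number $k^{EI}(\mathcal H)$ is the smallest nonnegative integer $k$ such that $EI^k(\mathcal H)$ has no hyperedges. *)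

theory Defs
  imports Main
begin

record 'a hypergraph =
  verts :: "'a set"
  edges :: "'a set set"

definition finite_hypergraph :: "'a hypergraph \<Rightarrow> bool" where
  "finite_hypergraph H \<longleftrightarrow> finite (verts H) \<and> edges H \<subseteq> Pow (verts H)"

definition complete_uniform :: "'a set \<Rightarrow> nat \<Rightarrow> 'a hypergraph" where
  "complete_uniform V r = \<lparr>verts = V, edges = {e. e \<subseteq> V \<and> card e = r}\<rparr>"

text \<open>For a nonempty family of hypergraphs on one common vertex set, the union
  below has that same vertex set.\<close>

definition hypergraph_Union :: "'a hypergraph set \<Rightarrow> 'a hypergraph" where
  "hypergraph_Union \<H> = \<lparr>verts = (\<Union>H\<in>\<H>. verts H), edges = (\<Union>H\<in>\<H>. edges H)\<rparr>"

definition EI :: "'a hypergraph \<Rightarrow> 'a hypergraph" where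
  "EI H = \<lparr>verts = verts H,
           edges = {e1 \<inter> e2 | e1 e2. e1 \<in> edges H \<and> e2 \<in> edges H \<and> e1 \<noteq> e2
                                  \<and> card (e1 \<inter> e2) \<ge> 2}\<rparr>"

definition EI_number :: "'a hypergraph \<Rightarrow> nat" where
  "EI_number H = (LEAST k. edges ((EI ^^ k) H) = {})"

text \<open>The minimum in the EI-number is attained for every finite hypergraph.\<close>

lemma EI_iterate_card_bound:
  assumes "finite_hypergraph H"
  shows "finite_hypergraph ((EI ^^ k) H) \<and>
    (\<forall>e\<in>edges ((EI ^^ k) H). card e + k \<le> card (verts H)) \<and> verts ((EI ^^ k) H) = verts H"
proof (induction k)
  case 0
  then show ?case
    using assms by (auto simp: finite_hypergraph_def intro: card_mono)
next
  case (Suc k)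
  let ?G = "(EI ^^ k) H"
  have card_e: "card e + Suc k \<le> card (verts H)" if "e \<in> edges (EI ?G)" for e
  proof -
    obtain e1 e2 where e: "e = e1 \<inter> e2" and E: "e1 \<in> edges ?G" "e2 \<in> edges ?G" "e1 \<noteq> e2"
      using \<open>e \<in> edges (EI ?G)\<close> by (auto simp: EI_def)
    have fin: "finite e1" "finite e2"
      using E(1,2) Suc unfolding finite_hypergraph_def by (meson PowD finite_subset subsetD)+
    have "e1 \<inter> e2 \<subset> e1 \<or> e1 \<inter> e2 \<subset> e2"
      using E(3) by blast
    then have "card e < card e1 \<or> card e < card e2"
      unfolding e using fin psubset_card_mono by metis
    then show ?thesis
      using Suc E by fastforce
  qed
  have "finite_hypergraph (EI ?G)" "verts (EI ?G) = verts H"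
    using Suc unfolding finite_hypergraph_def by (auto simp: EI_def[of ?G])
  with card_e show ?case by simp
qed

lemma EI_number_attained:
  assumes "finite_hypergraph H"
  shows "edges ((EI ^^ EI_number H) H) = {}"
proof -
  have "edges ((EI ^^ Suc (card (verts H))) H) = {}"
    using EI_iterate_card_bound[OF assms, of "Suc (card (verts H))"] by auto
  then show ?thesis
    unfolding EI_number_def by (rule LeastI)
qed

end

theory Submission
  imports Defs
begin

text \<open>Write \<open>L(a, b)\<close> for the hypergraph of all vertex subsets whose size lies in
  \<open>{a..b}\<close>. Two distinct edges of \<open>L(a, b)\<close> meet in at least \<open>2a - n\<close> and at most
  \<open>b - 1\<close> points, and every such set of size at least 2 is an intersection: a set \<open>S\<close> with
  \<open>|S| \<ge> a\<close> is the intersection of itself with \<open>S\<close> plus one point, and a smaller set is the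
  intersection of two \<open>a\<close>-sets that are disjoint outside \<open>S\<close>. So
  \<open>EI\<close> maps \<open>L(a, b)\<close> to \<open>L(max 2 (2a - n), b - 1)\<close>, and iterating from
  \<open>L(d, d)\<close> solves the recursion for the lower end.\<close>

definition levels :: "'a set \<Rightarrow> nat \<Rightarrow> nat \<Rightarrow> 'a hypergraph" where
  "levels V a b = \<lparr>verts = V, edges = {e. e \<subseteq> V \<and> a \<le> card e \<and> card e \<le> b}\<rparr>"

lemma complete_uniform_eq_levels: "complete_uniform V d = levels V d d"
  by (auto simp: complete_uniform_def levels_def)

text \<open>The family is nonempty because \<open>a \<le> b\<close>; an empty union would lose the
  vertex set \<open>V\<close>.\<close>

lemma Union_complete_uniform:
  assumes "a \<le> b"
  shows "hypergraph_Union (complete_uniform V ` {a..b}) = levels V a b"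
  using assms by (auto simp: hypergraph_Union_def complete_uniform_def levels_def)

lemma edges_levels_nonempty:
  assumes "finite V" "a \<le> b" "b \<le> card V"
  shows "edges (levels V a b) \<noteq> {}"
proof -
  obtain S where "S \<subseteq> V" "card S = b"
    using assms(3) by (meson obtain_subset_with_card_n)
  then show ?thesis
    using assms(2) by (auto simp: levels_def)
qed

text \<open>Outside \<open>S\<close> there are at least \<open>2 * (a - card S)\<close> vertices,
  enough room for two disjoint sets that each enlarge \<open>S\<close> to size
  \<open>a\<close>.\<close>

lemma obtain_extensions_with_inter:
  assumes "finite V" "S \<subseteq> V" "card S \<le> a" "2 * a \<le> card S + card V"
  obtains A B where "A \<subseteq> V" "B \<subseteq> V" "card A = a" "card B = a" "A \<inter> B = S"
proof -
  have finS: "finite S"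
    using assms(1,2) finite_subset by blast
  have "card (V - S) = card V - card S"
    using finS assms(2) by (rule card_Diff_subset)
  then have room: "2 * (a - card S) \<le> card (V - S)"
    using assms(3,4) by linarith
  obtain T where T: "T \<subseteq> V - S" "card T = a - card S" "finite T"
    using room obtain_subset_with_card_n[of "a - card S" "V - S"] by auto
  have "card (V - S - T) = card (V - S) - card T"
    using T by (intro card_Diff_subset)
  then have "a - card S \<le> card (V - S - T)"
    using room T(2) by linarith
  then obtain U where U: "U \<subseteq> V - S - T" "card U = a - card S" "finite U"
    by (meson obtain_subset_with_card_n)
  show thesis
  proof
    show "S \<union> T \<subseteq> V" "S \<union> U \<subseteq> V" "(S \<union> T) \<inter> (S \<union> U) = S"
      using assms(2) T U by blast+
    have "S \<inter> T = {}" "S \<inter> U = {}"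
      using T U by blast+
    then show "card (S \<union> T) = a" "card (S \<union> U) = a"
      using assms(3) finS T U by (simp_all add: card_Un_disjoint)
  qed
qed

lemma card_inter_less:
  assumes "finite A" "finite B" "A \<noteq> B" "card A \<le> b" "card B \<le> b"
  shows "card (A \<inter> B) < b"
proof -
  have "A \<inter> B \<subset> A \<or> A \<inter> B \<subset> B"
    using assms(3) by blast
  then show ?thesis
    using assms psubset_card_mono[of A "A \<inter> B"] psubset_card_mono[of B "A \<inter> B"] by linarith
qed

text \<open>Natural subtraction truncates \<open>2 * a - card V\<close> at 0, which the maximum with
  2 absorbs.\<close>

lemma EI_levels:
  assumes fin: "finite V" and ab: "a \<le> b" and bn: "b \<le> card V"
  shows "EI (levels V a b) = levels V (max 2 (2 * a - card V)) (b - 1)"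
proof -
  have "S \<in> edges (EI (levels V a b)) \<longleftrightarrow>
      S \<in> edges (levels V (max 2 (2 * a - card V)) (b - 1))" for S
  proof
    assume "S \<in> edges (EI (levels V a b))"
    then obtain A B where S: "S = A \<inter> B" "A \<noteq> B" "2 \<le> card S" and
      A: "A \<subseteq> V" "a \<le> card A" "card A \<le> b" and B: "B \<subseteq> V" "a \<le> card B" "card B \<le> b"
      by (auto simp: EI_def levels_def)
    have finAB: "finite A" "finite B"
      using A(1) B(1) fin finite_subset by blast+
    have "card (A \<union> B) \<le> card V"
      using A(1) B(1) fin by (simp add: card_mono)
    then have "2 * a \<le> card S + card V"
      using card_Un_Int[OF finAB] A(2) B(2) unfolding S(1) by linarith
    moreover have "card S < b"
      using card_inter_less[OF finAB] A B S by simp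
    ultimately show "S \<in> edges (levels V (max 2 (2 * a - card V)) (b - 1))"
      using S A(1) by (auto simp: levels_def)
  next
    assume "S \<in> edges (levels V (max 2 (2 * a - card V)) (b - 1))"
    then have S: "S \<subseteq> V" "2 \<le> card S" "2 * a \<le> card S + card V" "card S < b"
      by (auto simp: levels_def)
    have finS: "finite S"
      using S(1) fin finite_subset by blast
    have "\<exists>A B. A \<subseteq> V \<and> a \<le> card A \<and> card A \<le> b \<and> B \<subseteq> V \<and> a \<le> card B \<and> card B \<le> b
        \<and> A \<noteq> B \<and> S = A \<inter> B"
    proof (cases "a \<le> card S")
      case True
      \<comment> \<open>Since \<open>card S < b \<le> card V\<close>, some vertex lies outside
        \<open>S\<close>, and adding it keeps the size within \<open>b\<close>.\<close>
      have "S \<noteq> V"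
        using S(4) bn by auto
      then obtain x where "x \<in> V" "x \<notin> S"
        using S(1) by blast
      then show ?thesis
        using S finS True by (intro exI[of _ S] exI[of _ "insert x S"]) auto
    next
      case False
      then obtain A B where "A \<subseteq> V" "B \<subseteq> V" "card A = a" "card B = a" "A \<inter> B = S"
        using obtain_extensions_with_inter[OF fin S(1), of a] S(3) by auto
      \<comment> \<open>If \<open>A = B\<close>, then \<open>S = A\<close> would have
        \<open>a\<close> elements, but here \<open>card S < a\<close>.\<close>
      then show ?thesis
        using False ab by (intro exI[of _ A] exI[of _ B]) auto
    qed
    then show "S \<in> edges (EI (levels V a b))"
      using S(2) by (auto simp: EI_def levels_def)
  qed
  then have "edges (EI (levels V a b)) = edges (levels V (max 2 (2 * a - card V)) (b - 1))"
    by blast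
  then show ?thesis
    by (simp add: EI_def levels_def)
qed

text \<open>Passing from \<open>x\<close> to \<open>2 * x - n\<close> fixes \<open>n\<close> and
  doubles the difference from \<open>n\<close>, hence the power of 2. The uncapped value can be
  negative, so it is computed in the integers; the cap at 2 makes \<open>nat\<close>
  lossless.\<close>

definition lower_level :: "nat \<Rightarrow> nat \<Rightarrow> nat \<Rightarrow> nat" where
  "lower_level n d k = nat (max 2 (2 ^ k * (int d - int n) + int n))"

lemma lower_level_0: "2 \<le> d \<Longrightarrow> lower_level n d 0 = d"
  by (simp add: lower_level_def)

text \<open>Once the cap is active it stays active: from a value at most 2, the next one is at most
  \<open>4 - n \<le> 2\<close>.\<close>

lemma lower_level_Suc:
  assumes "2 \<le> n"
  shows "lower_level n d (Suc k) = max 2 (2 * lower_level n d k - n)"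
proof -
  define x where "x = 2 ^ k * (int d - int n)"
  have x: "2 ^ Suc k * (int d - int n) = 2 * x"
    by (simp add: x_def)
  show ?thesis
    using assms unfolding lower_level_def x x_def[symmetric] by linarith
qed

text \<open>The uncapped value is \<open>d - (2 ^ k - 1) * (n - d)\<close>, where
  \<open>2 ^ k - 1 \<ge> k\<close> and \<open>n - d \<ge> 1\<close>. So the range of sizes stays
  nonempty and \<open>EI_levels\<close> can be iterated.\<close>

lemma lower_level_le:
  assumes "d < n" "k + 2 \<le> d"
  shows "lower_level n d k \<le> d - k"
proof -
  have "int k \<le> 2 ^ k - 1"
    using less_exp[of k] by (metis of_nat_less_iff of_nat_numeral of_nat_power zle_diff1_eq)
  also have "\<dots> \<le> (2 ^ k - 1) * (int n - int d)"
    using assms(1) mult_left_mono[of 1 "int n - int d" "2 ^ k - 1"] by simp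
  finally have "2 ^ k * (int d - int n) + int n \<le> int d - int k"
    by (simp add: algebra_simps)
  then show ?thesis
    using assms(2) unfolding lower_level_def by linarith
qed

lemma EI_iterate_complete_uniform:
  assumes "finite V" "d < card V" "k + 2 \<le> d"
  shows "(EI ^^ k) (complete_uniform V d) = levels V (lower_level (card V) d k) (d - k)"
  using assms(3)
proof (induction k)
  case 0
  then show ?case
    by (simp add: complete_uniform_eq_levels lower_level_0)
next
  case (Suc k)
  have "EI (levels V (lower_level (card V) d k) (d - k)) =
      levels V (max 2 (2 * lower_level (card V) d k - card V)) (d - k - 1)"
    using assms Suc.prems by (intro EI_levels lower_level_le) auto
  then show ?case
    using Suc assms(2) by (simp add: lower_level_Suc)
qed

lemma EI_number_complete_uniform:
  assumes "finite V" "d < card V" "2 \<le> d"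
  shows "EI_number (complete_uniform V d) = d - 1"
  unfolding EI_number_def
proof (rule Least_equality)
  \<comment> \<open>After \<open>d - 2\<close> steps only the pairs are left; one more step asks for
    sizes at least 2 and at most 1.\<close>
  have le: "lower_level (card V) d (d - 2) \<le> 2"
    using lower_level_le[of d "card V" "d - 2"] assms by simp
  have "(EI ^^ (d - 1)) (complete_uniform V d) = EI ((EI ^^ (d - 2)) (complete_uniform V d))"
    using assms(3) by (simp add: Suc_diff_Suc numeral_2_eq_2 flip: funpow.simps(2) comp_apply[of EI])
  also have "\<dots> = EI (levels V (lower_level (card V) d (d - 2)) 2)"
    using EI_iterate_complete_uniform[of V d "d - 2"] assms by simp
  also have "\<dots> = levels V (max 2 (2 * lower_level (card V) d (d - 2) - card V)) (2 - 1)"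
    using assms le by (intro EI_levels) auto
  finally show "edges ((EI ^^ (d - 1)) (complete_uniform V d)) = {}"
    by (auto simp: levels_def)
next
  fix k
  assume empty: "edges ((EI ^^ k) (complete_uniform V d)) = {}"
  show "d - 1 \<le> k"
  proof (rule ccontr)
    assume "\<not> d - 1 \<le> k"
    then have k: "k + 2 \<le> d" by simp
    \<comment> \<open>Up to step \<open>d - 2\<close> the range of sizes is nonempty and its top
      \<open>d - k\<close> is at most \<open>card V\<close>, so an edge exists.\<close>
    then show False
      using empty EI_iterate_complete_uniform[OF assms(1,2) k]
        edges_levels_nonempty[OF assms(1) lower_level_le[OF assms(2) k]] assms(2)
      by simp
  qed
qed

theorem theorem5:
  fixes V :: "'a set" and n d :: nat
  assumes "finite V" and "card V = n"
    and "3 \<le> d" and "d + 1 \<le> n"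
  shows "(\<forall>k. 1 \<le> k \<and> k \<le> d - 2 \<longrightarrow>
            (EI ^^ k) (complete_uniform V d) =
              hypergraph_Union (complete_uniform V `
                {nat (max 2 (2 ^ k * (int d - int n) + int n)) .. d - k}))
         \<and> EI_number (complete_uniform V d) = d - 1"
proof (intro conjI allI impI)
  fix k
  assume "1 \<le> k \<and> k \<le> d - 2"
  then have k: "k + 2 \<le> d"
    using assms(3) by linarith
  show "(EI ^^ k) (complete_uniform V d) =
      hypergraph_Union (complete_uniform V `
        {nat (max 2 (2 ^ k * (int d - int n) + int n)) .. d - k})"
    using EI_iterate_complete_uniform[of V d k]
      Union_complete_uniform[OF lower_level_le[of d n k], of V] assms k by (simp add: lower_level_def)
next
  show "EI_number (complete_uniform V d) = d - 1"
    using EI_number_complete_uniform[of V d] assms by simp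
qed

end
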